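(* Let $\kappa>\lambda$ be cardinals with $\kappa$ regular and $\lambda$ singular, and let $D$ be a $(\lambda^+,\kappa)$-regular ultrafilter. Then either $D$ is $(\lambda,\kappa)$-regular, or $D$ is $(\omega,\kappa')$-regular for every (infinite) cardinal $\kappa'<\kappa$.
   Context: We work in ZFC. For infinite cardinals $\mu,\lambda$, an ultrafilter $D$ over a set $I$ is $(\mu,\lambda)$-regular if there is an indexed family $(X_\alpha)_{\alpha<\lambda}$ of members of $D$ such that $\bigcap_{\alpha\in A}X_\alpha=\emptyset$ whenever $A\subseteq\lambda$ and $|A|=\mu$. Equivalently, there is a function $f:I\to S_\mu(\lambda)$ such that $\{i\in I\mid \alpha\in f(i)\}\in D$ for every $\alpha<\lambda$, where $S_\mu(\lambda)$ is the set of all subsets of $\lambda$ of cardinality $<\mu$. *)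

theory Defs
  imports Main
begin

unbundle cardinal_syntax

text \<open>
  Cardinals are represented as \<^const>\<open>Card_order\<close> relations; the elements of
  \<open>Field \<nu>\<close> play the role of the ordinals \<open>\<alpha> < \<nu>\<close>. The index set \<open>I\<close> of an ultrafilter
  is the universe of the type \<open>'i\<close>, and a set \<open>S\<close> belongs to a filter \<open>D\<close> iff
  \<open>\<forall>\<^sub>F i in D. i \<in> S\<close>.
\<close>

definition ultrafilter :: "'i filter \<Rightarrow> bool" where
  "ultrafilter D \<longleftrightarrow> D \<noteq> bot \<and> (\<forall>P. eventually P D \<or> (\<forall>\<^sub>F i in D. \<not> P i))"

text \<open>The property of being \<open>(\<mu>, \<nu>)\<close>-regular, meant for infinite cardinals \<open>\<mu>\<close> and \<open>\<nu>\<close>.\<close>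

definition regular_filter :: "'i filter \<Rightarrow> 'm rel \<Rightarrow> 'l rel \<Rightarrow> bool" where
  "regular_filter D \<mu> \<nu> \<longleftrightarrow>
     (\<exists>X :: 'l \<Rightarrow> 'i set.
        (\<forall>\<alpha>\<in>Field \<nu>. \<forall>\<^sub>F i in D. i \<in> X \<alpha>) \<and>
        (\<forall>A. A \<subseteq> Field \<nu> \<and> |A| =o \<mu> \<longrightarrow> (\<Inter>\<alpha>\<in>A. X \<alpha>) = {}))"

text \<open>
  \<^const>\<open>regularCard\<close> is also satisfied by every finite cardinal, so infinity is required
  explicitly in the following notions.
\<close>

definition regular_cardinal :: "'a rel \<Rightarrow> bool" where
  "regular_cardinal \<kappa> \<longleftrightarrow> Cinfinite \<kappa> \<and> regularCard \<kappa>"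

definition singular_cardinal :: "'a rel \<Rightarrow> bool" where
  "singular_cardinal \<kappa> \<longleftrightarrow> Cinfinite \<kappa> \<and> \<not> regularCard \<kappa>"

text \<open>
  When quantifying over all cardinals \<open>\<kappa>' <o \<kappa>\<close> with \<open>\<kappa> :: 'k rel\<close>, it suffices to let
  \<open>\<kappa>'\<close> range over \<open>'k rel\<close>: every cardinal below \<open>\<kappa>\<close>, on whatever type, is order-isomorphic
  to a cardinal on a subset of \<open>Field \<kappa>\<close>, and \<^const>\<open>regular_filter\<close> is invariant under
  isomorphism of its cardinal arguments.
\<close>

end

theory Submission
  imports Defs
begin

text \<open>
  Call \<open>f : I \<rightarrow> \<kappa>\<close> unbounded if it exceeds every constant below \<open>\<kappa>\<close> modulo \<open>D\<close>; such functions
  exist because \<open>D\<close> is \<open>(\<nu>\<^sup>+, \<kappa>)\<close>-regular and \<open>\<kappa>\<close> is regular.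

  If some unbounded \<open>f\<close> is least modulo \<open>D\<close>, then for almost all \<open>i\<close> the at most \<open>\<nu>\<close> many \<open>\<alpha> < f i\<close>
  with \<open>i \<in> X \<alpha>\<close> are cofinal in \<open>f i\<close>. As \<open>\<nu>\<close> is singular, \<open>f i\<close> has a cofinal subset \<open>C i\<close> with fewer
  than \<open>\<nu>\<close> elements. By leastness, for every \<open>x\<close> there is \<open>y\<close> such that \<open>C i\<close> meets \<open>[x, y]\<close> for almost
  all \<open>i\<close>, and \<open>\<kappa>\<close> many disjoint intervals of this kind witness \<open>(\<nu>, \<kappa>)\<close>-regularity.

  If there is no least unbounded function, the same interval argument with finite sets \<open>C i\<close> shows
  that either \<open>D\<close> is \<open>(\<omega>, \<kappa>)\<close>-regular, or below any finite sets there is a further unbounded function.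
  The latter yields \<open>\<kappa>\<close> many unbounded functions that descend pointwise above certain thresholds.
  Fewer than \<open>\<kappa>\<close> of them have a common bound \<open>u\<close> of their thresholds, so the sets
  \<open>{i. u < f i}\<close> witness \<open>(\<omega>, \<kappa>')\<close>-regularity.
\<close>

section \<open>Pointwise form of regularity and change of the index set\<close>

lemma exact_card_subset:
  assumes "Card_order \<mu>" and "\<mu> \<le>o |B|"
  shows "\<exists>A\<subseteq>B. |A| =o \<mu>"
proof -
  have \<mu>: "|Field \<mu>| =o \<mu>" using assms(1) by (rule card_of_Field_ordIso)
  then have "|Field \<mu>| \<le>o |B|" using assms(2) by (rule ordIso_ordLeq_trans)
  then obtain e where e: "inj_on e (Field \<mu>)" "e ` Field \<mu> \<subseteq> B"
    using card_of_ordLeq by metis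
  have "|Field \<mu>| =o |e ` Field \<mu>|"
    using e(1) by (intro card_of_ordIsoI[of e]) (rule inj_on_imp_bij_betw)
  then have "|e ` Field \<mu>| =o \<mu>" using \<mu> ordIso_symmetric ordIso_transitive by blast
  with e(2) show ?thesis by blast
qed

lemma card_of_ordLess_or_ordLeq:
  assumes "Card_order \<mu>"
  shows "|B| <o \<mu> \<or> \<mu> \<le>o |B|"
  using assms card_of_Well_order card_order_on_well_order_on ordLess_or_ordLeq by blast

text \<open>A set of size at least \<mu> has a subset of size exactly \<mu>. So the condition on
  intersections bounds, for each point \<open>i\<close>, the number of indices whose sets contain
  \<open>i\<close>; sending \<open>i\<close> to these indices is the function into the small subsets
  of \<open>Field \<nu>\<close>.\<close>

lemma regular_filter_iff:
  fixes D :: "'i filter" and \<mu> :: "'m rel" and \<nu> :: "'l rel"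
  assumes "Card_order \<mu>"
  shows "regular_filter D \<mu> \<nu> \<longleftrightarrow>
    (\<exists>X :: 'l \<Rightarrow> 'i set. (\<forall>\<alpha>\<in>Field \<nu>. \<forall>\<^sub>F i in D. i \<in> X \<alpha>) \<and>
      (\<forall>i. |{\<alpha> \<in> Field \<nu>. i \<in> X \<alpha>}| <o \<mu>))"
proof -
  have "(\<forall>A. A \<subseteq> Field \<nu> \<and> |A| =o \<mu> \<longrightarrow> (\<Inter>\<alpha>\<in>A. X \<alpha>) = {}) \<longleftrightarrow>
      (\<forall>i. |{\<alpha> \<in> Field \<nu>. i \<in> X \<alpha>}| <o \<mu>)" for X :: "'l \<Rightarrow> 'i set"
  proof (intro iffI allI impI)
    fix i
    assume *: "\<forall>A. A \<subseteq> Field \<nu> \<and> |A| =o \<mu> \<longrightarrow> (\<Inter>\<alpha>\<in>A. X \<alpha>) = {}"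
    show "|{\<alpha> \<in> Field \<nu>. i \<in> X \<alpha>}| <o \<mu>"
    proof (rule ccontr)
      assume "\<not> ?thesis"
      then have "\<mu> \<le>o |{\<alpha> \<in> Field \<nu>. i \<in> X \<alpha>}|"
        using card_of_ordLess_or_ordLeq[OF assms] by blast
      then obtain A where A: "A \<subseteq> {\<alpha> \<in> Field \<nu>. i \<in> X \<alpha>}" "|A| =o \<mu>"
        using exact_card_subset[OF assms] by blast
      then have "(\<Inter>\<alpha>\<in>A. X \<alpha>) = {}"
        using * by blast
      with A(1) show False by blast
    qed
  next
    fix A
    assume *: "\<forall>i. |{\<alpha> \<in> Field \<nu>. i \<in> X \<alpha>}| <o \<mu>" and A: "A \<subseteq> Field \<nu> \<and> |A| =o \<mu>"
    show "(\<Inter>\<alpha>\<in>A. X \<alpha>) = {}"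
    proof (rule ccontr)
      assume "\<not> ?thesis"
      then obtain i where "A \<subseteq> {\<alpha> \<in> Field \<nu>. i \<in> X \<alpha>}" using A by blast
      then have "|A| <o \<mu>"
        using * card_of_mono1 ordLeq_ordLess_trans by blast
      with A show False using not_ordLess_ordIso by blast
    qed
  qed
  then show ?thesis unfolding regular_filter_def by simp
qed

text \<open>Allows witnesses indexed by any large enough set, such as a set of pairs: an injection
  of \<open>Field \<nu>\<close> into \<open>T\<close> pulls them back.\<close>

lemma regular_filterI:
  fixes T :: "'t set" and Y :: "'t \<Rightarrow> 'i set" and \<nu> :: "'l rel"
  assumes "Card_order \<mu>" and "Card_order \<nu>" and "\<nu> \<le>o |T|"
    and large: "\<And>t. t \<in> T \<Longrightarrow> \<forall>\<^sub>F i in D. i \<in> Y t"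
    and small: "\<And>i. |{t \<in> T. i \<in> Y t}| <o \<mu>"
  shows "regular_filter D \<mu> \<nu>"
proof -
  have "|Field \<nu>| \<le>o |T|"
    using assms(2,3) card_of_Field_ordIso ordIso_ordLeq_trans by blast
  then obtain e where e: "inj_on e (Field \<nu>)" "e ` Field \<nu> \<subseteq> T"
    using card_of_ordLeq by metis
  have "|{\<alpha> \<in> Field \<nu>. i \<in> Y (e \<alpha>)}| <o \<mu>" for i
  proof -
    have "|{\<alpha> \<in> Field \<nu>. i \<in> Y (e \<alpha>)}| \<le>o |{t \<in> T. i \<in> Y t}|"
      by (rule card_of_ordLeqI[of e]) (use e in \<open>auto simp: inj_on_def\<close>)
    then show ?thesis using small ordLeq_ordLess_trans by blast
  qed
  moreover have "\<forall>\<^sub>F i in D. i \<in> Y (e \<alpha>)" if "\<alpha> \<in> Field \<nu>" for \<alpha>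
    using large e(2) that by blast
  ultimately show ?thesis
    unfolding regular_filter_iff[OF assms(1)] by (intro exI[of _ "\<lambda>\<alpha>. Y (e \<alpha>)"]) simp
qed

lemma regular_filter_mono:
  assumes "Card_order \<mu>" and "Card_order \<nu>" and "\<nu> \<le>o \<nu>'" and "Card_order \<nu>'"
    and "regular_filter D \<mu> \<nu>'"
  shows "regular_filter D \<mu> \<nu>"
proof -
  obtain X where X: "\<forall>\<alpha>\<in>Field \<nu>'. \<forall>\<^sub>F i in D. i \<in> X \<alpha>"
      "\<forall>i. |{\<alpha> \<in> Field \<nu>'. i \<in> X \<alpha>}| <o \<mu>"
    using assms(5) unfolding regular_filter_iff[OF assms(1)] by blast
  have "\<nu> \<le>o |Field \<nu>'|"
    using assms(3,4) card_of_Field_ordIso ordIso_symmetric ordLeq_ordIso_trans by blast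
  then show ?thesis
    using regular_filterI[OF assms(1,2), of "Field \<nu>'" X D] X by blast
qed

section \<open>Large pairwise related sets, and small cofinal sets from singularity\<close>

text \<open>Stands in for a transfinite recursion of length \<kappa>: a maximal pairwise related
  set, given by Zorn's lemma, cannot have fewer than \<kappa> elements, as \<open>extend\<close>
  would enlarge it.\<close>

lemma large_pairwise_set:
  assumes "Card_order \<kappa>"
    and extend: "\<And>T. \<lbrakk>T \<subseteq> U; pairwise R T; |T| <o \<kappa>\<rbrakk> \<Longrightarrow> \<exists>x\<in>U - T. \<forall>y\<in>T. R x y \<and> R y x"
  shows "\<exists>T\<subseteq>U. pairwise R T \<and> \<kappa> \<le>o |T|"
proof -
  let ?P = "{T. T \<subseteq> U \<and> pairwise R T}"
  have "\<exists>M\<in>?P. \<forall>T\<in>?P. M \<subseteq> T \<longrightarrow> T = M"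
  proof (rule Zorn_Lemma)
    show "\<forall>C\<in>chains ?P. \<Union>C \<in> ?P"
    proof
      fix C assume C: "C \<in> chains ?P"
      then have "pairwise R (\<Union>C)"
        by (intro pairwise_chain_Union) (auto simp: chains_def)
      with C show "\<Union>C \<in> ?P" by (auto simp: chains_def)
    qed
  qed
  then obtain M where "M \<in> ?P" and max: "\<forall>T\<in>?P. M \<subseteq> T \<longrightarrow> T = M"
    by (elim bexE)
  then have M: "M \<subseteq> U" "pairwise R M" by simp_all
  have "\<not> |M| <o \<kappa>"
  proof
    assume "|M| <o \<kappa>"
    then obtain x where x: "x \<in> U - M" "\<forall>y\<in>M. R x y \<and> R y x"
      using extend M by blast
    then have "insert x M = M"
      using M by (intro max[rule_format]) (auto simp: pairwise_insert)
    with x(1) show False by blast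
  qed
  then have "\<kappa> \<le>o |M|" using card_of_ordLess_or_ordLeq[OF assms(1)] by blast
  with M show ?thesis by blast
qed

text \<open>Take \<open>K\<close> cofinal in \<nu> of size below \<nu> and inject \<open>B\<close>
  into \<nu>. Either the part of \<open>B\<close> sent below some \<open>k\<close> in
  \<open>K\<close> is already cofinal in \<open>P\<close>, or each such part leaves a point
  \<open>c k\<close> undominated. In the second case every \<open>b\<close> in \<open>B\<close> lies
  in one of these parts, hence below some \<open>c k\<close>, so the points \<open>c k\<close> are
  cofinal.\<close>

lemma singular_cofinal_subset:
  fixes \<nu> :: "'l rel" and P B :: "'a set" and le :: "'a \<Rightarrow> 'a \<Rightarrow> bool"
  assumes "singular_cardinal \<nu>" and "|B| \<le>o \<nu>" and "B \<subseteq> P"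
    and B: "\<And>x. x \<in> P \<Longrightarrow> \<exists>b\<in>B. le x b"
    and linear: "\<And>x y. \<lbrakk>x \<in> P; y \<in> P\<rbrakk> \<Longrightarrow> le x y \<or> le y x"
    and trans: "\<And>x y z. \<lbrakk>x \<in> P; y \<in> P; z \<in> P; le x y; le y z\<rbrakk> \<Longrightarrow> le x z"
  shows "\<exists>C\<subseteq>P. |C| <o \<nu> \<and> (\<forall>x\<in>P. \<exists>c\<in>C. le x c)"
proof -
  have cinf: "Cinfinite \<nu>" and "\<not> regularCard \<nu>"
    using assms(1) unfolding singular_cardinal_def by auto
  then have card: "Card_order \<nu>" by simp
  obtain K where K: "K \<subseteq> Field \<nu>" "cofinal K \<nu>" "\<not> |K| =o \<nu>"
    using \<open>\<not> regularCard \<nu>\<close> unfolding regularCard_def by blast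
  have "|K| \<le>o \<nu>"
    using K(1) card card_of_mono1 card_of_Field_ordIso ordLeq_ordIso_trans by blast
  with K(3) have K_small: "|K| <o \<nu>"
    using ordLeq_iff_ordLess_or_ordIso by blast
  have "|B| \<le>o |Field \<nu>|"
    using assms(2) card card_of_Field_ordIso ordIso_symmetric ordLeq_ordIso_trans by blast
  then obtain e where e: "inj_on e B" "e ` B \<subseteq> Field \<nu>"
    using card_of_ordLeq by metis
  define B' where "B' k = {b \<in> B. e b \<in> underS \<nu> k}" for k
  have B'_small: "|B' k| <o \<nu>" if "k \<in> Field \<nu>" for k
  proof -
    have "|B' k| \<le>o |underS \<nu> k|"
      by (rule card_of_ordLeqI[of e]) (use e in \<open>auto simp: inj_on_def B'_def\<close>)
    then show ?thesis
      using card_of_underS[OF card that] ordLeq_ordLess_trans by blast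
  qed
  show ?thesis
  proof (cases "\<exists>k\<in>K. \<forall>x\<in>P. \<exists>c\<in>B' k. le x c")
    case True
    then obtain k where "k \<in> K" "\<forall>x\<in>P. \<exists>c\<in>B' k. le x c" by blast
    then show ?thesis
      using B'_small K(1) assms(3) by (intro exI[of _ "B' k"]) (auto simp: B'_def)
  next
    case False
    then obtain c where c: "\<And>k. k \<in> K \<Longrightarrow> c k \<in> P \<and> (\<forall>b\<in>B' k. \<not> le (c k) b)" by metis
    have "\<exists>y\<in>c ` K. le x y" if x: "x \<in> P" for x
    proof -
      obtain b where b: "b \<in> B" "le x b" using B x by blast
      with e obtain k where k: "k \<in> K" "e b \<noteq> k" "(e b, k) \<in> \<nu>"
        using K(2) unfolding cofinal_def by blast
      then have "b \<in> B' k" using b by (simp add: B'_def underS_def)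
      then have "le b (c k)" using c[OF k(1)] linear[of b "c k"] b assms(3) by blast
      then have "le x (c k)" using trans[of x b "c k"] b x c[OF k(1)] assms(3) by blast
      with k show ?thesis by blast
    qed
    moreover have "|c ` K| <o \<nu>" using K_small card_of_image ordLeq_ordLess_trans by blast
    ultimately show ?thesis using c by (intro exI[of _ "c ` K"]) blast
  qed
qed

section \<open>Order and boundedness in a regular cardinal\<close>

context
  fixes \<kappa> :: "'k rel"
  assumes reg: "regular_cardinal \<kappa>"
begin

private abbreviation (input) le :: "'k \<Rightarrow> 'k \<Rightarrow> bool" (infix "\<sqsubseteq>" 50)
  where "x \<sqsubseteq> y \<equiv> (x, y) \<in> \<kappa>"

private abbreviation (input) lt :: "'k \<Rightarrow> 'k \<Rightarrow> bool" (infix "\<sqsubset>" 50)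
  where "x \<sqsubset> y \<equiv> (x, y) \<in> \<kappa> \<and> x \<noteq> y"

private lemma card: "Card_order \<kappa>" and cinf: "Cinfinite \<kappa>"
  using reg unfolding regular_cardinal_def by auto

private lemma wo: "wo_rel \<kappa>"
  using card unfolding wo_rel_def card_order_on_def by blast

private lemma le_trans: "x \<sqsubseteq> y \<Longrightarrow> y \<sqsubseteq> z \<Longrightarrow> x \<sqsubseteq> z"
  using wo_rel.TRANS[OF wo] by (meson transD)

private lemma le_antisym: "x \<sqsubseteq> y \<Longrightarrow> y \<sqsubseteq> x \<Longrightarrow> x = y"
  using wo_rel.ANTISYM[OF wo] by (meson antisymD)

private lemma le_refl: "x \<in> Field \<kappa> \<Longrightarrow> x \<sqsubseteq> x"
  using wo_rel.REFL[OF wo] by (meson refl_onD)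

private lemma le_lt_trans: "x \<sqsubseteq> y \<Longrightarrow> y \<sqsubset> z \<Longrightarrow> x \<sqsubset> z"
  and lt_le_trans: "x \<sqsubset> y \<Longrightarrow> y \<sqsubseteq> z \<Longrightarrow> x \<sqsubset> z"
  using le_trans le_antisym by blast+

private lemma not_lt: "x \<in> Field \<kappa> \<Longrightarrow> y \<in> Field \<kappa> \<Longrightarrow> \<not> x \<sqsubset> y \<longleftrightarrow> y \<sqsubseteq> x"
  using wo_rel.TOTALS[OF wo] le_antisym le_refl by blast

private lemma in_Field: "x \<sqsubseteq> y \<Longrightarrow> x \<in> Field \<kappa>" "x \<sqsubseteq> y \<Longrightarrow> y \<in> Field \<kappa>"
  by (auto intro: FieldI1 FieldI2)

private lemma wf_lt: "wf (\<kappa> - Id)"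
  using wo_rel.WF[OF wo] .

private lemma small_bounded:
  assumes "A \<subseteq> Field \<kappa>" and "|A| <o \<kappa>"
  shows "\<exists>u\<in>Field \<kappa>. \<forall>a\<in>A. a \<sqsubset> u"
proof -
  have "\<not> cofinal A \<kappa>"
    using reg assms not_ordLess_ordIso unfolding regular_cardinal_def regularCard_def by blast
  then obtain v where v: "v \<in> Field \<kappa>" "\<forall>a\<in>A. \<not> v \<sqsubset> a"
    unfolding cofinal_def by blast
  \<comment> \<open>\<open>v\<close> bounds \<open>A\<close> only weakly and may itself lie in
    \<open>A\<close>; any larger \<open>u\<close> is a strict bound.\<close>
  obtain u where u: "u \<in> Field \<kappa>" "v \<sqsubset> u"
    using infinite_Card_order_limit[OF card _ v(1)] cinf unfolding cinfinite_def by blast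
  have "a \<sqsubset> u" if "a \<in> A" for a
    using v u that assms(1) le_lt_trans not_lt by blast
  with u show ?thesis by blast
qed

private lemma least_exists:
  assumes "x \<in> A" and "A \<subseteq> Field \<kappa>"
  shows "\<exists>m\<in>A. \<forall>a\<in>A. m \<sqsubseteq> a"
proof -
  obtain m where m: "m \<in> A" "\<And>y. y \<sqsubset> m \<Longrightarrow> y \<notin> A"
    using wfE_min[OF wf_lt assms(1)] by (metis DiffI pair_in_Id_conv)
  then have "m \<sqsubseteq> a" if "a \<in> A" for a
    using not_lt[of a m] that assms(2) by blast
  with m show ?thesis by blast
qed

section \<open>Regularity from disjoint intervals\<close>

text \<open>Given \<kappa> many disjoint intervals from \<open>x\<close> to \<open>b x\<close>, each
  met by \<open>C i\<close> for almost all \<open>i\<close>, a fixed \<open>C i\<close> meets fewer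
  than \<mu> of them, because points chosen in different intervals differ.\<close>

lemma regular_filter_if_hits_intervals:
  fixes D :: "'i filter" and \<mu> :: "'m rel" and C :: "'i \<Rightarrow> 'k set"
  assumes \<mu>: "Card_order \<mu>" and small: "\<And>i. |C i| <o \<mu>"
    and hits: "\<And>x. x \<in> Field \<kappa> \<Longrightarrow> \<exists>y\<in>Field \<kappa>. \<forall>\<^sub>F i in D. \<exists>c\<in>C i. x \<sqsubseteq> c \<and> c \<sqsubseteq> y"
  shows "regular_filter D \<mu> \<kappa>"
proof -
  have "\<exists>b. \<forall>x\<in>Field \<kappa>. b x \<in> Field \<kappa> \<and> (\<forall>\<^sub>F i in D. \<exists>c\<in>C i. x \<sqsubseteq> c \<and> c \<sqsubseteq> b x)"
    by (intro bchoice ballI) (use hits in \<open>simp add: Bex_def\<close>)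
  then obtain b where b: "\<And>x. x \<in> Field \<kappa> \<Longrightarrow> b x \<in> Field \<kappa>"
      "\<And>x. x \<in> Field \<kappa> \<Longrightarrow> \<forall>\<^sub>F i in D. \<exists>c\<in>C i. x \<sqsubseteq> c \<and> c \<sqsubseteq> b x"
    by blast
  \<comment> \<open>For distinct \<open>x\<close> and \<open>y\<close>, having both
    \<open>R x y\<close> and \<open>R y x\<close> keeps the intervals that start at \<open>x\<close>
    and \<open>y\<close> disjoint.\<close>
  define R where "R x y \<longleftrightarrow> (x \<sqsubset> y \<longrightarrow> b x \<sqsubset> y)" for x y
  have "\<exists>T\<subseteq>Field \<kappa>. pairwise R T \<and> \<kappa> \<le>o |T|"
  proof (rule large_pairwise_set[OF card])
    fix T assume T: "T \<subseteq> Field \<kappa>" "|T| <o \<kappa>"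
    then have "|b ` T| <o \<kappa>" using card_of_image ordLeq_ordLess_trans by blast
    moreover have "b ` T \<subseteq> Field \<kappa>" using T(1) b(1) by blast
    ultimately obtain u v where u: "u \<in> Field \<kappa>" "\<forall>a\<in>T. a \<sqsubset> u"
      and v: "v \<in> Field \<kappa>" "\<forall>a\<in>b ` T. a \<sqsubset> v"
      using small_bounded T by meson
    \<comment> \<open>The next interval starts at \<open>w\<close>, the larger of \<open>u\<close>
      and \<open>v\<close>, beyond all earlier start points and end points.\<close>
    obtain w where "w \<in> Field \<kappa>" "u \<sqsubseteq> w" "v \<sqsubseteq> w"
      using u(1) v(1) le_refl not_lt by blast
    then have w: "w \<in> Field \<kappa>" "\<forall>a\<in>T. a \<sqsubset> w \<and> b a \<sqsubset> w"
      using u v lt_le_trans by blast+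
    then show "\<exists>x\<in>Field \<kappa> - T. \<forall>y\<in>T. R x y \<and> R y x"
      unfolding R_def using le_antisym by blast
  qed
  then obtain T where T: "T \<subseteq> Field \<kappa>" "pairwise R T" "\<kappa> \<le>o |T|" by blast
  define Y where "Y x = {i. \<exists>c\<in>C i. x \<sqsubseteq> c \<and> c \<sqsubseteq> b x}" for x
  show ?thesis
  proof (rule regular_filterI[OF \<mu> card T(3)])
    show "\<forall>\<^sub>F i in D. i \<in> Y t" if "t \<in> T" for t
      using b(2)[of t] T(1) that by (auto simp: Y_def)
    fix i
    define c where "c x = (SOME c. c \<in> C i \<and> x \<sqsubseteq> c \<and> c \<sqsubseteq> b x)" for x
    have c: "c x \<in> C i \<and> x \<sqsubseteq> c x \<and> c x \<sqsubseteq> b x" if "i \<in> Y x" for x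
      unfolding c_def by (rule someI_ex) (use that in \<open>auto simp: Y_def\<close>)
    have ne: "c x \<noteq> c y" if "x \<in> T" "y \<in> T" "i \<in> Y x" "i \<in> Y y" "x \<sqsubset> y" for x y
    proof -
      have "b x \<sqsubset> y" using T(2) that unfolding pairwise_def R_def by blast
      then have "c x \<sqsubset> c y"
        using c[OF that(3)] c[OF that(4)] le_lt_trans lt_le_trans by meson
      then show ?thesis by blast
    qed
    have "inj_on c {t \<in> T. i \<in> Y t}"
    proof (rule inj_onI, rule ccontr)
      fix x y assume *: "x \<in> {t \<in> T. i \<in> Y t}" "y \<in> {t \<in> T. i \<in> Y t}" "c x = c y" "x \<noteq> y"
      then have "x \<sqsubset> y \<or> y \<sqsubset> x" using T(1) not_lt by blast
      then show False using ne[of x y] ne[of y x] * by auto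
    qed
    then have "|{t \<in> T. i \<in> Y t}| \<le>o |C i|"
      by (rule card_of_ordLeqI) (use c in blast)
    then show "|{t \<in> T. i \<in> Y t}| <o \<mu>" using small ordLeq_ordLess_trans by blast
  qed
qed

section \<open>Unbounded functions modulo the ultrafilter\<close>

definition unbounded :: "'i filter \<Rightarrow> ('i \<Rightarrow> 'k) \<Rightarrow> bool" where
  "unbounded D f \<longleftrightarrow> (\<forall>x\<in>Field \<kappa>. \<forall>\<^sub>F i in D. x \<sqsubset> f i)"

text \<open>Only minimality is demanded. For an ultrafilter the order modulo \<open>D\<close> is
  total, so the class of \<open>f\<close> is the supremum of the constants in the
  ultrapower.\<close>

definition least_unbounded :: "'i filter \<Rightarrow> ('i \<Rightarrow> 'k) \<Rightarrow> bool" where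
  "least_unbounded D f \<longleftrightarrow> unbounded D f \<and> (\<forall>g. unbounded D g \<longrightarrow> \<not> (\<forall>\<^sub>F i in D. g i \<sqsubset> f i))"

text \<open>The form in which leastness is applied: \<open>g\<close> is not unbounded, and the
  ultrafilter turns the failure to exceed some \<open>y\<close> almost everywhere into a bound by
  \<open>y\<close> almost everywhere.\<close>

lemma bounded_below_least_unbounded:
  assumes D: "ultrafilter D" and "least_unbounded D f" and g: "\<forall>\<^sub>F i in D. g i \<sqsubset> f i"
  shows "\<exists>y\<in>Field \<kappa>. \<forall>\<^sub>F i in D. g i \<sqsubseteq> y"
proof -
  have "\<not> unbounded D g" using assms unfolding least_unbounded_def by blast
  then obtain y where y: "y \<in> Field \<kappa>" "\<forall>\<^sub>F i in D. \<not> y \<sqsubset> g i"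
    using D unfolding unbounded_def ultrafilter_def by blast
  have "\<forall>\<^sub>F i in D. g i \<sqsubseteq> y"
    using y(2) g by eventually_elim (use y(1) not_lt in_Field in blast)
  with y(1) show ?thesis by blast
qed

text \<open>Each \<open>i\<close> lies in at most \<nu> many sets \<open>X \<alpha>\<close>. By
  regularity of \<kappa> their indices have a strict bound, which serves as
  \<open>f i\<close>.\<close>

lemma unbounded_exists:
  assumes "regular_filter D (cardSuc \<nu>) \<kappa>" and "Card_order \<nu>" and "\<nu> <o \<kappa>"
  shows "\<exists>f. unbounded D f"
proof -
  obtain X where X: "\<forall>\<alpha>\<in>Field \<kappa>. \<forall>\<^sub>F i in D. i \<in> X \<alpha>"
    "\<forall>i. |{\<alpha> \<in> Field \<kappa>. i \<in> X \<alpha>}| <o cardSuc \<nu>"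
    using assms(1) unfolding regular_filter_iff[OF cardSuc_Card_order[OF assms(2)]] by blast
  have "\<exists>u. \<forall>\<alpha>\<in>Field \<kappa>. i \<in> X \<alpha> \<longrightarrow> \<alpha> \<sqsubset> u" for i
  proof -
    have "|{\<alpha> \<in> Field \<kappa>. i \<in> X \<alpha>}| \<le>o \<nu>"
      using X(2) cardSuc_ordLeq_ordLess[OF assms(2) card_of_Card_order] by blast
    then have "|{\<alpha> \<in> Field \<kappa>. i \<in> X \<alpha>}| <o \<kappa>" using assms(3) ordLeq_ordLess_trans by blast
    then show ?thesis using small_bounded[of "{\<alpha> \<in> Field \<kappa>. i \<in> X \<alpha>}"] by blast
  qed
  then have "\<exists>f. \<forall>i. \<forall>\<alpha>\<in>Field \<kappa>. i \<in> X \<alpha> \<longrightarrow> \<alpha> \<sqsubset> f i" by (intro choice allI)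
  then obtain f where f: "\<And>i \<alpha>. \<alpha> \<in> Field \<kappa> \<Longrightarrow> i \<in> X \<alpha> \<Longrightarrow> \<alpha> \<sqsubset> f i" by blast
  have "unbounded D f" unfolding unbounded_def
  proof
    fix x assume "x \<in> Field \<kappa>"
    with X(1) have "\<forall>\<^sub>F i in D. i \<in> X x" by blast
    then show "\<forall>\<^sub>F i in D. x \<sqsubset> f i" by eventually_elim (use f \<open>x \<in> Field \<kappa>\<close> in blast)
  qed
  then show ?thesis by blast
qed

section \<open>The case of a least unbounded function\<close>

lemma regular_filter_if_least_unbounded:
  fixes D :: "'i filter" and \<nu> :: "'l rel"
  assumes D: "ultrafilter D" and f: "least_unbounded D f"
    and \<nu>: "singular_cardinal \<nu>" and "regular_filter D (cardSuc \<nu>) \<kappa>"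
  shows "regular_filter D \<nu> \<kappa>"
proof -
  have cinf\<nu>: "Cinfinite \<nu>" and card\<nu>: "Card_order \<nu>"
    using \<nu> unfolding singular_cardinal_def by auto
  have unb: "\<And>x. x \<in> Field \<kappa> \<Longrightarrow> \<forall>\<^sub>F i in D. x \<sqsubset> f i"
    using f unfolding least_unbounded_def unbounded_def by blast
  obtain X where X: "\<forall>\<alpha>\<in>Field \<kappa>. \<forall>\<^sub>F i in D. i \<in> X \<alpha>"
    "\<forall>i. |{\<alpha> \<in> Field \<kappa>. i \<in> X \<alpha>}| <o cardSuc \<nu>"
    using assms(4) unfolding regular_filter_iff[OF cardSuc_Card_order[OF card\<nu>]] by blast
  define B where "B i = {\<alpha>. \<alpha> \<sqsubset> f i \<and> i \<in> X \<alpha>}" for i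
  have B_le: "|B i| \<le>o \<nu>" for i
  proof -
    have "|B i| \<le>o |{\<alpha> \<in> Field \<kappa>. i \<in> X \<alpha>}|"
      by (rule card_of_mono1) (auto simp: B_def in_Field)
    moreover have "|{\<alpha> \<in> Field \<kappa>. i \<in> X \<alpha>}| \<le>o \<nu>"
      using X(2) cardSuc_ordLeq_ordLess[OF card\<nu> card_of_Card_order] by blast
    ultimately show ?thesis by (rule ordLeq_transitive)
  qed
  define cof where "cof A i \<longleftrightarrow> (\<forall>x. x \<sqsubset> f i \<longrightarrow> (\<exists>a\<in>A. x \<sqsubseteq> a))" for A i
  \<comment> \<open>Otherwise some \<open>g i\<close> below \<open>f i\<close> is not dominated by
    \<open>B i\<close>, for almost all \<open>i\<close>. Leastness bounds \<open>g\<close> by a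
    constant \<open>y\<close>, but almost always \<open>y\<close> belongs to
    \<open>B i\<close>.\<close>
  have cof_B: "\<forall>\<^sub>F i in D. cof (B i) i"
  proof (rule ccontr)
    assume "\<not> ?thesis"
    then have not_cof: "\<forall>\<^sub>F i in D. \<not> cof (B i) i" using D unfolding ultrafilter_def by blast
    define g where "g i = (SOME x. x \<sqsubset> f i \<and> (\<forall>a\<in>B i. \<not> x \<sqsubseteq> a))" for i
    have g: "g i \<sqsubset> f i \<and> (\<forall>a\<in>B i. \<not> g i \<sqsubseteq> a)" if "\<not> cof (B i) i" for i
      unfolding g_def by (rule someI_ex) (use that in \<open>auto simp: cof_def\<close>)
    have "\<forall>\<^sub>F i in D. g i \<sqsubset> f i" using not_cof by eventually_elim (use g in blast)
    then obtain y where y: "y \<in> Field \<kappa>" "\<forall>\<^sub>F i in D. g i \<sqsubseteq> y"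
      using bounded_below_least_unbounded D f by blast
    have "\<forall>\<^sub>F i in D. i \<in> X y" using X(1) y(1) by blast
    with not_cof y(2) unb[OF y(1)] have "\<forall>\<^sub>F i in D. False"
      by eventually_elim (use g in \<open>auto simp: B_def\<close>)
    then show False using D unfolding ultrafilter_def by simp
  qed
  have "\<exists>C. |C| <o \<nu> \<and> (cof (B i) i \<longrightarrow> cof C i \<and> (\<forall>c\<in>C. c \<sqsubset> f i))" for i
  proof (cases "cof (B i) i")
    case True
    have "\<exists>C\<subseteq>{x. x \<sqsubset> f i}. |C| <o \<nu> \<and> (\<forall>x\<in>{x. x \<sqsubset> f i}. \<exists>c\<in>C. x \<sqsubseteq> c)"
    proof (rule singular_cofinal_subset[OF \<nu> B_le])
      show "B i \<subseteq> {x. x \<sqsubset> f i}" by (auto simp: B_def)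
      show "\<exists>b\<in>B i. x \<sqsubseteq> b" if "x \<in> {x. x \<sqsubset> f i}" for x
        using True that unfolding cof_def by blast
      show "x \<sqsubseteq> y \<or> y \<sqsubseteq> x" if "x \<in> {x. x \<sqsubset> f i}" "y \<in> {x. x \<sqsubset> f i}" for x y
        using that not_lt in_Field by blast
    qed (use le_trans in blast)
    then show ?thesis unfolding cof_def by blast
  next
    case False
    \<comment> \<open>The empty set is a harmless default: these \<open>i\<close> form a set
      negligible modulo \<open>D\<close>.\<close>
    have "|{} :: 'k set| <o \<nu>"
      using cinf\<nu> Cinfinite_gt_empty by blast
    then show ?thesis using False by blast
  qed
  then have "\<exists>C. \<forall>i. |C i| <o \<nu> \<and> (cof (B i) i \<longrightarrow> cof (C i) i \<and> (\<forall>c\<in>C i. c \<sqsubset> f i))"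
    by (intro choice allI)
  then obtain C where C_small: "\<And>i. |C i| <o \<nu>"
    and C: "\<And>i. cof (B i) i \<Longrightarrow> cof (C i) i \<and> (\<forall>c\<in>C i. c \<sqsubset> f i)" by blast
  show ?thesis
  proof (rule regular_filter_if_hits_intervals[OF card\<nu> C_small])
    fix x assume x: "x \<in> Field \<kappa>"
    \<comment> \<open>Cofinality of \<open>C i\<close> provides a point \<open>t i\<close> at or
      above \<open>x\<close>, still below \<open>f i\<close>. Leastness then bounds \<open>t\<close>
      by a constant, the right end of the interval.\<close>
    define t where "t i = (SOME c. c \<in> C i \<and> x \<sqsubseteq> c)" for i
    have t: "\<forall>\<^sub>F i in D. t i \<in> C i \<and> x \<sqsubseteq> t i \<and> t i \<sqsubset> f i"
      using cof_B unb[OF x]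
    proof eventually_elim
      case (elim i)
      then have "\<exists>c. c \<in> C i \<and> x \<sqsubseteq> c" using C unfolding cof_def by blast
      then have "t i \<in> C i \<and> x \<sqsubseteq> t i" unfolding t_def by (rule someI_ex)
      then show ?case using C elim by blast
    qed
    then have "\<forall>\<^sub>F i in D. t i \<sqsubset> f i" by eventually_elim blast
    then obtain y where y: "y \<in> Field \<kappa>" "\<forall>\<^sub>F i in D. t i \<sqsubseteq> y"
      using bounded_below_least_unbounded D f by blast
    have "\<forall>\<^sub>F i in D. \<exists>c\<in>C i. x \<sqsubseteq> c \<and> c \<sqsubseteq> y"
      using t y(2) by eventually_elim blast
    with y(1) show "\<exists>y\<in>Field \<kappa>. \<forall>\<^sub>F i in D. \<exists>c\<in>C i. x \<sqsubseteq> c \<and> c \<sqsubseteq> y" by blast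
  qed
qed

section \<open>The case without a least unbounded function\<close>

text \<open>As \<open>D\<close> is not (\<omega>, \<kappa>)-regular, the interval criterion fails
  for \<open>C\<close> at some \<open>x\<close>: no interval starting at \<open>x\<close> is met
  almost everywhere. So the least element of \<open>C i\<close> at or above \<open>x\<close> is
  unbounded as a function of \<open>i\<close>, and some unbounded function lies below it.\<close>

lemma unbounded_below_finite_sets:
  fixes D :: "'i filter" and C :: "'i \<Rightarrow> 'k set"
  assumes D: "ultrafilter D" and "\<not> regular_filter D natLeq \<kappa>"
    and no_least: "\<And>f. \<not> least_unbounded D f" and f0: "unbounded D f0"
    and fin: "\<And>i. finite (C i)"
  shows "\<exists>x\<in>Field \<kappa>. \<exists>g. unbounded D g \<and> (\<forall>i. \<forall>c\<in>C i. x \<sqsubset> c \<longrightarrow> g i \<sqsubset> c)"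
proof -
  have "|C i| <o natLeq" for i using fin finite_iff_ordLess_natLeq by blast
  then obtain x where x: "x \<in> Field \<kappa>"
    and miss: "\<And>y. y \<in> Field \<kappa> \<Longrightarrow> \<not> (\<forall>\<^sub>F i in D. \<exists>c\<in>C i. x \<sqsubseteq> c \<and> c \<sqsubseteq> y)"
    using regular_filter_if_hits_intervals[OF natLeq_Card_order, of C D] assms(2) by blast
  define A where "A i = {c \<in> C i. x \<sqsubseteq> c}" for i
  \<comment> \<open>If \<open>C i\<close> has no element at or above \<open>x\<close>, it imposes no
    constraint; the default \<open>f0 i\<close> keeps \<open>h\<close> unbounded.\<close>
  define h where "h i = (if A i = {} then f0 i else SOME m. m \<in> A i \<and> (\<forall>c\<in>A i. m \<sqsubseteq> c))" for i
  have h: "h i \<in> A i \<and> (\<forall>c\<in>A i. h i \<sqsubseteq> c)" if ne: "A i \<noteq> {}" for i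
  proof -
    have "A i \<subseteq> Field \<kappa>" using in_Field by (auto simp: A_def)
    with ne have "\<exists>m. m \<in> A i \<and> (\<forall>c\<in>A i. m \<sqsubseteq> c)" using least_exists by (metis ex_in_conv)
    from someI_ex[OF this] show ?thesis using ne by (simp add: h_def)
  qed
  have "unbounded D h" unfolding unbounded_def
  proof
    fix y assume y: "y \<in> Field \<kappa>"
    then have "\<forall>\<^sub>F i in D. \<not> (\<exists>c\<in>C i. x \<sqsubseteq> c \<and> c \<sqsubseteq> y)"
      using miss D unfolding ultrafilter_def by blast
    moreover have "\<forall>\<^sub>F i in D. y \<sqsubset> f0 i" using f0 y unfolding unbounded_def by blast
    ultimately show "\<forall>\<^sub>F i in D. y \<sqsubset> h i"
    proof eventually_elim
      case (elim i)
      show ?case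
      proof (cases "A i = {}")
        case True
        then show ?thesis using elim by (simp add: h_def)
      next
        case False
        then have "h i \<in> C i" "x \<sqsubseteq> h i" using h[OF False] by (auto simp: A_def)
        then show ?thesis using elim not_lt[of y "h i"] y in_Field by blast
      qed
    qed
  qed
  then obtain g where g: "unbounded D g" "\<forall>\<^sub>F i in D. g i \<sqsubset> h i"
    using no_least unfolding least_unbounded_def by blast
  \<comment> \<open>The bound by \<open>h\<close> holds only almost everywhere, but the conclusion
    concerns every \<open>i\<close>. The value \<open>x\<close> repairs the exceptions, being below
    each \<open>c\<close> in question.\<close>
  define g' where "g' i = (if g i \<sqsubset> h i then g i else x)" for i
  have "unbounded D g'" unfolding unbounded_def
  proof
    fix y assume "y \<in> Field \<kappa>"
    then have "\<forall>\<^sub>F i in D. y \<sqsubset> g i" using g(1) unfolding unbounded_def by blast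
    then show "\<forall>\<^sub>F i in D. y \<sqsubset> g' i" using g(2) by eventually_elim (simp add: g'_def)
  qed
  moreover have "g' i \<sqsubset> c" if "c \<in> C i" "x \<sqsubset> c" for i c
  proof -
    have "h i \<sqsubseteq> c" using h[of i] that by (auto simp: A_def)
    then show ?thesis using that lt_le_trans[of "g i" "h i" c] by (auto simp: g'_def)
  qed
  ultimately show ?thesis using x by blast
qed

text \<open>
  Pairs are ordered by their thresholds, and the functions decrease above the thresholds. Hence,
  for fixed \<open>i\<close>, infinitely many values \<open>f i\<close> above all thresholds would be an infinite descent.
\<close>

definition descending :: "'k \<times> ('i \<Rightarrow> 'k) \<Rightarrow> 'k \<times> ('i \<Rightarrow> 'k) \<Rightarrow> bool" where
  "descending p q \<longleftrightarrow> fst p \<noteq> fst q \<and>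
     (fst p \<sqsubset> fst q \<longrightarrow> (\<forall>i. fst q \<sqsubset> snd p i \<longrightarrow> snd q i \<sqsubset> snd p i))"

lemma finite_above_thresholds:
  assumes T: "pairwise descending T" and u: "\<forall>p\<in>T. fst p \<sqsubset> u"
  shows "finite {p \<in> T. u \<sqsubset> snd p i}"
proof -
  define S where "S = {p \<in> T. u \<sqsubset> snd p i}"
  have S: "p \<in> S \<Longrightarrow> p \<in> T \<and> u \<sqsubset> snd p i" for p by (simp add: S_def)
  \<comment> \<open>On \<open>S\<close>, values and thresholds are ordered oppositely:
    \<open>u\<close> exceeds all thresholds, so every value in play is high enough for the descent
    to apply.\<close>
  have order: "fst q \<sqsubset> fst p" if "p \<in> S" "q \<in> S" "p \<noteq> q" "snd p i \<sqsubseteq> snd q i" for p q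
  proof (rule ccontr)
    assume "\<not> fst q \<sqsubset> fst p"
    moreover have "fst p \<sqsubset> u" "fst q \<sqsubset> u" using u S that by blast+
    moreover have pq: "descending p q" using T S that unfolding pairwise_def by blast
    ultimately have "fst p \<sqsubset> fst q"
      using not_lt[of "fst q" "fst p"] in_Field unfolding descending_def by blast
    moreover have "fst q \<sqsubset> snd p i"
      using \<open>fst q \<sqsubset> u\<close> S[of p] that(1) le_trans lt_le_trans by blast
    ultimately have "snd q i \<sqsubset> snd p i" using pq unfolding descending_def by blast
    then show False using that le_antisym by blast
  qed
  \<comment> \<open>A member of least value has the largest threshold. Thus every nonempty set of
    thresholds from \<open>S\<close> has a maximum, which a well-order permits only for finite
    sets.\<close>
  have top: "\<exists>p\<in>Q. \<forall>q\<in>Q. p \<noteq> q \<longrightarrow> fst q \<sqsubset> fst p" if Q: "Q \<subseteq> S" "Q \<noteq> {}" for Q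
  proof -
    obtain q where "q \<in> Q" using Q by blast
    moreover have "(\<lambda>p. snd p i) ` Q \<subseteq> Field \<kappa>" using Q S in_Field by blast
    ultimately obtain p where "p \<in> Q" "\<forall>q\<in>Q. snd p i \<sqsubseteq> snd q i"
      using least_exists[of "snd q i" "(\<lambda>p. snd p i) ` Q"] by auto
    then show ?thesis using order Q by blast
  qed
  \<comment> \<open>Induction on the threshold: the predecessors of \<open>p\<close> are their top
    member \<open>m\<close> together with predecessors of \<open>m\<close>.\<close>
  have below: "p \<in> S \<longrightarrow> finite {q \<in> S. fst q \<sqsubset> fst p}" for p
  proof (induction p rule: wf_induct[OF wf_inv_image[OF wf_lt, of fst]])
    case (1 p)
    let ?Q = "{q \<in> S. fst q \<sqsubset> fst p}"
    show ?case
    proof (cases "?Q = {}")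
      case False
      then obtain m where m: "m \<in> ?Q" "\<forall>q\<in>?Q. m \<noteq> q \<longrightarrow> fst q \<sqsubset> fst m" using top[of ?Q] by blast
      then have "?Q \<subseteq> insert m {q \<in> S. fst q \<sqsubset> fst m}" by auto
      moreover have "finite {q \<in> S. fst q \<sqsubset> fst m}"
        using 1[THEN spec, of m] m(1) by simp
      ultimately show ?thesis using finite_subset by blast
    qed (use finite.emptyI in metis)
  qed
  have "finite S"
  proof (cases "S = {}")
    case False
    then obtain m where m: "m \<in> S" "\<forall>q\<in>S. m \<noteq> q \<longrightarrow> fst q \<sqsubset> fst m" using top[of S] by blast
    then have "S \<subseteq> insert m {q \<in> S. fst q \<sqsubset> fst m}" by auto
    then show ?thesis using below[of m] m(1) finite_subset by blast
  qed (use finite.emptyI in metis)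
  then show ?thesis by (simp add: S_def)
qed

lemma regular_filter_if_no_least_unbounded:
  fixes D :: "'i filter" and \<kappa>' :: "'m rel"
  assumes D: "ultrafilter D" and no_least: "\<And>f. \<not> least_unbounded D f" and f0: "unbounded D f0"
    and \<kappa>': "Card_order \<kappa>'" "\<kappa>' <o \<kappa>"
  shows "regular_filter D natLeq \<kappa>'"
proof (cases "regular_filter D natLeq \<kappa>")
  case True
  then show ?thesis
    using regular_filter_mono[OF natLeq_Card_order \<kappa>'(1) ordLess_imp_ordLeq[OF \<kappa>'(2)] card] by blast
next
  case False
  let ?U = "Field \<kappa> \<times> {f. unbounded D f}"
  have bound: "\<exists>u\<in>Field \<kappa>. \<forall>p\<in>T. fst p \<sqsubset> u" if "T \<subseteq> ?U" "|T| <o \<kappa>" for T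
  proof -
    have "|fst ` T| <o \<kappa>" using that(2) card_of_image ordLeq_ordLess_trans by blast
    moreover have "fst ` T \<subseteq> Field \<kappa>" using that(1) by auto
    ultimately show ?thesis using small_bounded[of "fst ` T"] by blast
  qed
  have "\<exists>T\<subseteq>?U. pairwise descending T \<and> \<kappa> \<le>o |T|"
  proof (rule large_pairwise_set[OF card])
    fix T assume T: "T \<subseteq> ?U" "pairwise descending T" "|T| <o \<kappa>"
    obtain u where u: "u \<in> Field \<kappa>" "\<forall>p\<in>T. fst p \<sqsubset> u" using bound T by blast
    \<comment> \<open>The values above \<open>u\<close> of the functions built so far are finitely
      many at each \<open>i\<close>, so another unbounded function fits below them.\<close>
    define C where "C i = (\<lambda>p. snd p i) ` {p \<in> T. u \<sqsubset> snd p i}" for i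
    have "finite (C i)" for i
      unfolding C_def using finite_above_thresholds[OF T(2) u(2)] by blast
    then obtain x g where x: "x \<in> Field \<kappa>" and g: "unbounded D g"
        "\<And>i c. c \<in> C i \<Longrightarrow> x \<sqsubset> c \<Longrightarrow> g i \<sqsubset> c"
      using unbounded_below_finite_sets[OF D False no_least f0, of C] by blast
    \<comment> \<open>The new threshold must lie above all old ones, hence \<open>u\<close>, and be
      at least \<open>x\<close>, where \<open>g\<close> starts to descend.\<close>
    obtain v where v: "v \<in> Field \<kappa>" "u \<sqsubseteq> v" "x \<sqsubseteq> v"
      using u(1) x le_refl not_lt by blast
    have lt: "fst p \<sqsubset> v" if "p \<in> T" for p using u(2) v(2) that lt_le_trans by blast
    have "descending p (v, g) \<and> descending (v, g) p" if p: "p \<in> T" for p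
    proof -
      have "g i \<sqsubset> snd p i" if "v \<sqsubset> snd p i" for i
      proof (rule g(2))
        show "snd p i \<in> C i" using p that v(2) le_lt_trans unfolding C_def by blast
        show "x \<sqsubset> snd p i" using that v(3) le_lt_trans by blast
      qed
      then show ?thesis
        using lt[OF p] le_antisym unfolding descending_def by auto
    qed
    moreover have "(v, g) \<in> ?U - T" using v(1) g(1) lt by force
    ultimately show "\<exists>p\<in>?U - T. \<forall>q\<in>T. descending p q \<and> descending q p" by blast
  qed
  then obtain T where T: "T \<subseteq> ?U" "pairwise descending T" "\<kappa> \<le>o |T|" by blast
  have "\<kappa>' \<le>o |T|" using T(3) \<kappa>'(2) ordLess_imp_ordLeq ordLeq_transitive by blast
  \<comment> \<open>Cutting down to \<kappa>' many pairs makes their thresholds bounded, by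
    regularity of \<kappa>; all of \<open>T\<close> would be too large for this.\<close>
  then obtain T' where T': "T' \<subseteq> T" "|T'| =o \<kappa>'"
    using exact_card_subset[OF \<kappa>'(1)] by blast
  have "|T'| <o \<kappa>" using T'(2) \<kappa>'(2) by (rule ordIso_ordLess_trans)
  then obtain u where u: "u \<in> Field \<kappa>" "\<forall>p\<in>T'. fst p \<sqsubset> u" using bound[of T'] T(1) T'(1) by blast
  show ?thesis
  proof (rule regular_filterI[OF natLeq_Card_order \<kappa>'(1) ordIso_imp_ordLeq[OF ordIso_symmetric[OF T'(2)]]])
    show "\<forall>\<^sub>F i in D. i \<in> {i. u \<sqsubset> snd p i}" if "p \<in> T'" for p
      using T(1) T'(1) that u(1) unfolding unbounded_def by auto
    show "|{p \<in> T'. i \<in> {i. u \<sqsubset> snd p i}}| <o natLeq" for i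
      unfolding mem_Collect_eq finite_iff_ordLess_natLeq[symmetric]
      using pairwise_subset[OF T(2) T'(1)] u(2) by (rule finite_above_thresholds)
  qed
qed

end

theorem corollary6p4:
  fixes \<kappa> :: "'k rel" and \<nu> :: "'l rel" and D :: "'i filter"
  assumes "regular_cardinal \<kappa>"
    and "singular_cardinal \<nu>"
    and "\<nu> <o \<kappa>"
    and "ultrafilter D"
    and "regular_filter D (cardSuc \<nu>) \<kappa>"
  shows "regular_filter D \<nu> \<kappa> \<or>
    (\<forall>\<kappa>' :: 'k rel. Cinfinite \<kappa>' \<and> \<kappa>' <o \<kappa> \<longrightarrow> regular_filter D natLeq \<kappa>')"
proof (cases "\<exists>f. least_unbounded \<kappa> D f")
  case True
  then show ?thesis
    using regular_filter_if_least_unbounded[OF assms(1,4) _ assms(2,5)] by blast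
next
  case False
  have "Card_order \<nu>" using assms(2) unfolding singular_cardinal_def by blast
  then obtain f0 where "unbounded \<kappa> D f0"
    using unbounded_exists[OF assms(1,5) _ assms(3)] by blast
  then show ?thesis
    using regular_filter_if_no_least_unbounded[OF assms(1,4)] False by blast
qed

end
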